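(* Let $r\ge 3$, let $H$ be a connected $r$-uniform hypergraph with at least one edge, and let $v$ be a vertex of $H$. For integers $k,l\ge 0$ let $H^{(r)}_{k,l}$ be the $r$-uniform hypergraph obtained from $H$ by attaching a path $A_k^{(r)}$ and a path $A_l^{(r)}$ at $v$. If $l\ge k\ge 1$, then $\rho(H^{(r)}_{k,l})>\rho(H^{(r)}_{k-1,l+1})$.
   Context: An $r$-uniform hypergraph ($r$-graph) $H=(V,E)$ has a finite vertex set $V$ and a set $E$ of $r$-element subsets of $V$ (edges). The spectral radius $\rho(H)$ of an $r$-graph $H$ on vertices $v_1,\dots,v_\nu$ is the maximum of $P_H(x)=r!\sum_{\{v_{i_1},\dots,v_{i_r}\}\in E(H)}x_{i_1}\cdots x_{i_r}$ over all $x\in\mathbb{R}^\nu$ with $\sum_i|x_i|^r=1$. $A_k^{(r)}$ (path of length $k$) is the $r$-graph obtained from the ordinary path graph with edges $v_0v_1,v_1v_2,\dots,v_{k-1}v_k$ by adding $r-2$ new vertices to each edge (all new vertices distinct, each belonging only to that edge); $A_0^{(r)}$ is the single vertex $v_0$. Attaching $A_k^{(r)}$ and $A_l^{(r)}$ at $v$ means adding copies of these two paths, disjoint from each other and from $H$ except that the end vertex $v_0$ of each is identified with $v$. In particular, attaching $A_0^{(r)}$ changes nothing. $H$ is not required to be such that any two edges share at most one vertex. *)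

theory Defs
  imports "HOL-Analysis.Analysis"
begin

record 'a hypergraph =
  verts :: "'a set"
  edges :: "'a set set"

definition uniform_hypergraph :: "nat \<Rightarrow> 'a hypergraph \<Rightarrow> bool" where
  "uniform_hypergraph r H \<longleftrightarrow>
     finite (verts H) \<and> (\<forall>e\<in>edges H. e \<subseteq> verts H \<and> card e = r)"

definition connected_hypergraph :: "'a hypergraph \<Rightarrow> bool" where
  "connected_hypergraph H \<longleftrightarrow>
     verts H \<noteq> {} \<and>
     (\<forall>u\<in>verts H. \<forall>w\<in>verts H. (u, w) \<in> {(a, b). \<exists>e\<in>edges H. a \<in> e \<and> b \<in> e}\<^sup>*)"

definition poly_form :: "nat \<Rightarrow> 'a hypergraph \<Rightarrow> ('a \<Rightarrow> real) \<Rightarrow> real" where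
  "poly_form r H x = fact r * (\<Sum>e\<in>edges H. \<Prod>u\<in>e. x u)"

text \<open>Vectors are functions on the whole vertex type, but only their values on the vertex set
  matter.  The supremum is a maximum; see \<open>spectral_radius_is_max\<close> below.\<close>

definition spectral_radius :: "nat \<Rightarrow> 'a hypergraph \<Rightarrow> real" where
  "spectral_radius r H = (SUP x \<in> {x. (\<Sum>u\<in>verts H. \<bar>x u\<bar> ^ r) = 1}. poly_form r H x)"

text \<open>\<open>Spine i\<close> is the vertex \<open>v\<^sub>i\<close> of the underlying ordinary path; \<open>Extra i j\<close> is the
  \<open>j\<close>-th vertex added to the edge joining \<open>Spine i\<close> and \<open>Spine (Suc i)\<close>.\<close>

datatype path_vertex = Spine nat | Extra nat nat

definition path_edge :: "nat \<Rightarrow> nat \<Rightarrow> path_vertex set" where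
  "path_edge r i = {Spine i, Spine (Suc i)} \<union> Extra i ` {..<r - 2}"

definition hyperpath :: "nat \<Rightarrow> nat \<Rightarrow> path_vertex hypergraph" where
  "hyperpath r k =
     \<lparr>verts = Spine ` {..k} \<union> {Extra i j |i j. i < k \<and> j < r - 2},
      edges = path_edge r ` {..<k}\<rparr>"

text \<open>Disjoint union of \<open>H\<close> and \<open>G\<close> with the vertex \<open>u\<close> of \<open>G\<close> identified with the vertex \<open>v\<close>
  of \<open>H\<close>.\<close>

definition coalesce ::
    "'a hypergraph \<Rightarrow> 'a \<Rightarrow> 'b hypergraph \<Rightarrow> 'b \<Rightarrow> ('a + 'b) hypergraph" where
  "coalesce H v G u =
     (let glue = (\<lambda>y. if y = u then Inl v else Inr y) in
      \<lparr>verts = Inl ` verts H \<union> glue ` verts G,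
       edges = (`) Inl ` edges H \<union> (`) glue ` edges G\<rparr>)"

definition attach_path :: "nat \<Rightarrow> nat \<Rightarrow> 'a hypergraph \<Rightarrow> 'a \<Rightarrow> ('a + path_vertex) hypergraph" where
  "attach_path r k H v = coalesce H v (hyperpath r k) (Spine 0)"

text \<open>After the first attachment the vertex \<open>v\<close> of \<open>H\<close> has become \<open>Inl v\<close>.\<close>

definition attach_two_paths ::
    "nat \<Rightarrow> nat \<Rightarrow> nat \<Rightarrow> 'a hypergraph \<Rightarrow> 'a \<Rightarrow> (('a + path_vertex) + path_vertex) hypergraph"
  where
  "attach_two_paths r k l H v = attach_path r l (attach_path r k H v) (Inl v)"

lemma spectral_radius_is_max:
  fixes H :: "'a hypergraph"
  assumes H: "uniform_hypergraph r H" and ne: "verts H \<noteq> {}" and r: "r > 0"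
  shows "\<exists>x. (\<Sum>u\<in>verts H. \<bar>x u\<bar> ^ r) = 1 \<and> poly_form r H x = spectral_radius r H"
    and "(\<Sum>u\<in>verts H. \<bar>y u\<bar> ^ r) = 1 \<Longrightarrow> poly_form r H y \<le> spectral_radius r H"
proof -
  let ?V = "verts H"
  define S where "S = {x :: 'a \<Rightarrow> real. (\<Sum>u\<in>?V. \<bar>x u\<bar> ^ r) = 1}"
  define B where "B = (\<lambda>u. if u \<in> ?V then {-1..1} else {0::real})"
  have fin: "finite ?V" and sub: "\<And>e. e \<in> edges H \<Longrightarrow> e \<subseteq> ?V"
    using H by (auto simp: uniform_hypergraph_def)
  have "compact (PiE UNIV B)"
    using compactin_PiE[of "\<lambda>_. euclidean" "UNIV :: 'a set" B]
    by (auto simp: B_def euclidean_product_topology)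
  moreover have "closed S"
    unfolding S_def by (intro closed_Collect_eq continuous_intros
        continuous_on_product_coordinates)
  ultimately have comp: "compact (PiE UNIV B \<inter> S)"
    by (rule compact_Int_closed)
  have cont: "continuous_on (PiE UNIV B \<inter> S) (poly_form r H)"
    unfolding poly_form_def by (intro continuous_intros
        continuous_on_subset[OF continuous_on_product_coordinates subset_UNIV])
  define proj where "proj = (\<lambda>(x :: 'a \<Rightarrow> real) u. if u \<in> ?V then x u else 0)"
  have proj_form: "poly_form r H (proj x) = poly_form r H x" for x
    unfolding poly_form_def proj_def using sub
    by (intro arg_cong2[where f = "(*)"] refl sum.cong prod.cong) auto
  have proj_in: "proj x \<in> PiE UNIV B \<inter> S" if "x \<in> S" for x
  proof -
    have "\<bar>x u\<bar> \<le> 1" if u: "u \<in> ?V" for u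
    proof -
      have "\<bar>x u\<bar> ^ r \<le> (\<Sum>u\<in>?V. \<bar>x u\<bar> ^ r)"
        using u fin by (intro member_le_sum) auto
      also have "\<dots> = 1" using \<open>x \<in> S\<close> by (simp add: S_def)
      finally show ?thesis using r by (simp add: power_le_one_iff)
    qed
    moreover have "proj x \<in> S"
      using \<open>x \<in> S\<close> by (simp add: S_def proj_def)
    ultimately show ?thesis
      by (auto simp: B_def proj_def abs_le_iff)
  qed
  obtain w where w: "w \<in> ?V" using ne by blast
  have "(\<lambda>u. if u = w then 1 else 0) \<in> S"
  proof -
    have "(\<Sum>u\<in>?V. \<bar>if u = w then 1 else 0 :: real\<bar> ^ r) = (\<Sum>u\<in>?V. if u = w then 1 else 0)"
      using r by (intro sum.cong) auto
    then show ?thesis using w fin by (simp add: S_def)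
  qed
  then have "PiE UNIV B \<inter> S \<noteq> {}" using proj_in by blast
  then obtain z where z: "z \<in> PiE UNIV B \<inter> S"
      and zmax: "\<And>y. y \<in> PiE UNIV B \<inter> S \<Longrightarrow> poly_form r H y \<le> poly_form r H z"
    using continuous_attains_sup[OF comp _ cont] by blast
  have le: "poly_form r H y \<le> poly_form r H z" if "y \<in> S" for y
    using zmax[OF proj_in[OF that]] by (simp add: proj_form)
  have eq: "spectral_radius r H = poly_form r H z"
    unfolding spectral_radius_def S_def[symmetric]
    using z le by (intro cSup_eq_maximum) auto
  show "\<exists>x. (\<Sum>u\<in>?V. \<bar>x u\<bar> ^ r) = 1 \<and> poly_form r H x = spectral_radius r H"
    using z by (auto simp: eq S_def)
  show "(\<Sum>u\<in>?V. \<bar>y u\<bar> ^ r) = 1 \<Longrightarrow> poly_form r H y \<le> spectral_radius r H"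
    using le by (simp add: eq S_def)
qed

end

theory Submission
  imports Defs
begin

text \<open>Let \<open>x\<close> be a positive maximiser for \<open>H\<^bsub>k-1,l+1\<^esub>\<close>; by Lagrange multipliers
  \<open>\<lambda> x\<^sub>u\<^sup>r\<close> is the sum of the products of \<open>x\<close> over the edges at \<open>u\<close>, where \<open>\<lambda>\<close> is the spectral
  radius divided by \<open>(r-1)!\<close>. Keep \<open>x\<close> on \<open>H\<close> and replace the two arms by arms of lengths \<open>k\<close>
  and \<open>l\<close> carrying solutions of the same eigenvalue equation with the same value at \<open>v\<close>. The new vector
  can violate the equation only at \<open>v\<close>. With \<open>\<mu> = \<lambda>\<^bsup>r/2\<^esup>\<close> and
  \<open>t\<^sub>n = U\<^sub>n\<^sub>-\<^sub>1(\<mu>/2) / U\<^sub>n(\<mu>/2)\<close> (Chebyshev polynomials), the defect there is a positive multiple of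
  \<open>(t\<^sub>k - t\<^sub>k\<^sub>-\<^sub>1) - (t\<^sub>l\<^sub>+\<^sub>1 - t\<^sub>l)\<close>, whose sign is that of
  \<open>U\<^sub>l U\<^sub>l\<^sub>+\<^sub>1 - U\<^sub>k\<^sub>-\<^sub>1 U\<^sub>k = U\<^sub>l\<^sub>-\<^sub>k U\<^sub>k\<^sub>+\<^sub>l\<^sub>+\<^sub>1\<close>. Both factors are positive: the first by
  positivity of \<open>x\<close> on the long arm, the second by the eigenvalue equation at \<open>v\<close>, where the edges of
  \<open>H\<close> contribute a positive term. A positive vector with nonnegative, not identically zero defect
  has Rayleigh quotient above \<open>\<lambda>\<close>.\<close>

section \<open>Local forms and the Rayleigh bound\<close>

text \<open>The factor \<open>x u\<close> stays in each product, so up to a constant this is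
  \<open>x u\<close> times the partial derivative of the form; the eigenvalue equation then has
  exponent \<open>r\<close> instead of \<open>r - 1\<close>.\<close>

definition local_form :: "'a hypergraph \<Rightarrow> ('a \<Rightarrow> real) \<Rightarrow> 'a \<Rightarrow> real" where
  "local_form H x u = (\<Sum>e\<in>{e \<in> edges H. u \<in> e}. \<Prod>w\<in>e. x w)"

lemma uniform_hypergraphD:
  assumes "uniform_hypergraph r H"
  shows "finite (verts H)" "finite (edges H)"
    "\<And>e. e \<in> edges H \<Longrightarrow> e \<subseteq> verts H" "\<And>e. e \<in> edges H \<Longrightarrow> card e = r"
    "\<And>e. e \<in> edges H \<Longrightarrow> finite e"
proof -
  show fin: "finite (verts H)" and sub: "\<And>e. e \<in> edges H \<Longrightarrow> e \<subseteq> verts H"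
    and "\<And>e. e \<in> edges H \<Longrightarrow> card e = r"
    using assms by (auto simp: uniform_hypergraph_def)
  show "finite (edges H)"
    using fin sub by (intro finite_subset[of "edges H" "Pow (verts H)"]) auto
  show "\<And>e. e \<in> edges H \<Longrightarrow> finite e"
    using fin sub finite_subset by blast
qed

text \<open>Double counting: each edge contributes its product once at each of its \<open>r\<close>
  vertices.\<close>

lemma poly_form_sum_local_form:
  assumes H: "uniform_hypergraph r H" and r: "r > 0"
  shows "poly_form r H x = fact (r - 1) * (\<Sum>u\<in>verts H. local_form H x u)"
proof -
  note fin = uniform_hypergraphD[OF H]
  have "(\<Sum>u\<in>verts H. local_form H x u)
      = (\<Sum>u\<in>verts H. \<Sum>e\<in>edges H. if u \<in> e then \<Prod>w\<in>e. x w else 0)"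
    unfolding local_form_def using fin(2) by (intro sum.cong refl sum.inter_filter) 
  also have "\<dots> = (\<Sum>e\<in>edges H. \<Sum>u\<in>verts H. if u \<in> e then \<Prod>w\<in>e. x w else 0)"
    by (rule sum.swap)
  also have "\<dots> = (\<Sum>e\<in>edges H. real r * (\<Prod>w\<in>e. x w))"
  proof (rule sum.cong[OF refl])
    fix e assume e: "e \<in> edges H"
    have "(\<Sum>u\<in>verts H. if u \<in> e then \<Prod>w\<in>e. x w else 0) = (\<Sum>u\<in>verts H \<inter> e. \<Prod>w\<in>e. x w)"
      by (rule sum.inter_restrict[OF fin(1), symmetric])
    also have "verts H \<inter> e = e" using fin(3)[OF e] by blast
    finally show "(\<Sum>u\<in>verts H. if u \<in> e then \<Prod>w\<in>e. x w else 0) = real r * (\<Prod>w\<in>e. x w)"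
      using fin(4)[OF e] by simp
  qed
  finally show ?thesis
    using r by (simp add: poly_form_def sum_distrib_left fact_reduce[of r] mult_ac)
qed

text \<open>Both sides are homogeneous of degree \<open>r\<close>, so \<open>y\<close> can be
  normalised; if its norm vanishes, so does every edge product. This form of the bound lets later
  arguments vary a vector without renormalising it.\<close>

lemma poly_form_le_spectral_radius:
  assumes H: "uniform_hypergraph r H" and ne: "verts H \<noteq> {}" and r: "r > 0"
  shows "poly_form r H y \<le> spectral_radius r H * (\<Sum>u\<in>verts H. \<bar>y u\<bar> ^ r)"
proof -
  note fin = uniform_hypergraphD[OF H]
  define N where "N = (\<Sum>u\<in>verts H. \<bar>y u\<bar> ^ r)"
  have N0: "N \<ge> 0" unfolding N_def by (intro sum_nonneg) auto
  show ?thesis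
  proof (cases "N = 0")
    case True
    then have y0: "y u = 0" if "u \<in> verts H" for u
      using that fin(1) r unfolding N_def by (subst (asm) sum_nonneg_eq_0_iff) auto
    have "(\<Prod>w\<in>e. y w) = 0" if e: "e \<in> edges H" for e
    proof -
      have "e \<noteq> {}" using fin(4)[OF e] r by auto
      then show ?thesis using fin(3,5)[OF e] y0 by (auto simp: prod_zero_iff)
    qed
    then show ?thesis using True by (simp add: poly_form_def N_def)
  next
    case False
    define s where "s = root r N"
    have s: "s > 0" "s ^ r = N" using False N0 r by (simp_all add: s_def)
    have "(\<Sum>u\<in>verts H. \<bar>y u / s\<bar> ^ r) = 1"
      using s False by (simp add: power_divide flip: sum_divide_distrib N_def)
    then have "poly_form r H (\<lambda>u. y u / s) \<le> spectral_radius r H"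
      by (rule spectral_radius_is_max(2)[OF H ne r])
    also have "poly_form r H (\<lambda>u. y u / s) = poly_form r H y / N"
      using fin(4) s by (simp add: poly_form_def prod_dividef flip: sum_divide_distrib)
    finally show ?thesis using s N0 False by (simp add: N_def[symmetric] divide_simps)
  qed
qed

text \<open>Summing the local inequalities compares the form with \<open>lam\<close> times the norm,
  and strictness at one vertex survives the sum.\<close>

lemma spectral_radius_gt_of_local_form:
  assumes H: "uniform_hypergraph r H" and r: "r > 0"
    and pos: "\<And>u. u \<in> verts H \<Longrightarrow> x u > 0"
    and ge: "\<And>u. u \<in> verts H \<Longrightarrow> local_form H x u \<ge> lam * x u ^ r"
    and v: "v \<in> verts H" "local_form H x v > lam * x v ^ r"
  shows "fact (r - 1) * lam < spectral_radius r H"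
proof -
  note fin = uniform_hypergraphD[OF H]
  define N where "N = (\<Sum>u\<in>verts H. \<bar>x u\<bar> ^ r)"
  have N: "N > 0" unfolding N_def using pos v(1) fin(1) by (intro sum_pos) force+
  have "lam * N = (\<Sum>u\<in>verts H. lam * x u ^ r)"
    unfolding N_def sum_distrib_left using pos by (intro sum.cong) (auto simp: less_imp_le)
  also have "\<dots> < (\<Sum>u\<in>verts H. local_form H x u)"
    using fin(1) ge v by (intro sum_strict_mono_ex1) auto
  finally have "fact (r - 1) * lam * N < poly_form r H x"
    by (simp add: poly_form_sum_local_form[OF H r] mult.assoc)
  also have "\<dots> \<le> spectral_radius r H * N"
    using poly_form_le_spectral_radius[OF H _ r] v(1) unfolding N_def by blast
  finally show ?thesis using N by simp
qed

section \<open>Existence of a positive eigenvector\<close>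

text \<open>A chain from \<open>a\<close> to \<open>b\<close> must enter \<open>Z\<close> at some
  step, and the edge realising that step crosses the boundary.\<close>

lemma connected_cut_edge:
  assumes "connected_hypergraph H" "a \<in> verts H" "b \<in> verts H" "a \<notin> Z" "b \<in> Z"
  obtains e where "e \<in> edges H" "e \<inter> Z \<noteq> {}" "\<not> e \<subseteq> Z"
proof -
  have "(a, b) \<in> {(a, b). \<exists>e\<in>edges H. a \<in> e \<and> b \<in> e}\<^sup>*"
    using assms by (simp add: connected_hypergraph_def)
  then have "\<exists>e\<in>edges H. e \<inter> Z \<noteq> {} \<and> \<not> e \<subseteq> Z"
    using assms(5)
  proof induction
    case base
    then show ?case using assms(4) by blast
  next
    case (step y z)
    then show ?case by (cases "y \<in> Z") auto
  qed
  then show thesis using that by blast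
qed

text \<open>If a nonnegative maximiser vanished on a set \<open>Z\<close>, raising it to \<open>\<epsilon>\<close> on \<open>Z\<close> would gain at least
  a multiple of \<open>\<epsilon>\<^sup>r\<^sup>-\<^sup>1\<close> through an edge crossing the boundary of \<open>Z\<close> and cost only
  a multiple of \<open>\<epsilon>\<^sup>r\<close>.\<close>

lemma positive_maximiser:
  assumes H: "uniform_hypergraph r H" and conn: "connected_hypergraph H" and r: "r > 0"
  obtains x where "\<And>u. u \<in> verts H \<Longrightarrow> x u > 0" "(\<Sum>u\<in>verts H. x u ^ r) = 1"
    "poly_form r H x = spectral_radius r H"
proof -
  note fin = uniform_hypergraphD[OF H]
  have ne: "verts H \<noteq> {}" using conn by (simp add: connected_hypergraph_def)
  define \<rho> where "\<rho> = spectral_radius r H"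
  obtain x0 where x0: "(\<Sum>u\<in>verts H. \<bar>x0 u\<bar> ^ r) = 1" "poly_form r H x0 = \<rho>"
    using spectral_radius_is_max(1)[OF H ne r] unfolding \<rho>_def by blast
  define x where "x = (\<lambda>u. \<bar>x0 u\<bar>)"
  have x_ge: "x u \<ge> 0" for u by (simp add: x_def)
  have xnorm: "(\<Sum>u\<in>verts H. x u ^ r) = 1" using x0 by (simp add: x_def)
  \<comment> \<open>Taking absolute values keeps the norm and cannot lower the form, so
    \<open>x\<close> is a maximiser as well.\<close>
  have "poly_form r H x0 \<le> poly_form r H x"
    unfolding poly_form_def x_def
    by (intro mult_left_mono sum_mono) (auto simp: abs_prod[symmetric])
  moreover have "poly_form r H x \<le> \<rho>"
    using spectral_radius_is_max(2)[OF H ne r, of x] xnorm x_ge by (simp add: \<rho>_def)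
  ultimately have xform: "poly_form r H x = \<rho>" using x0 by simp
  have "x u > 0" if u: "u \<in> verts H" for u
  proof (rule ccontr)
    assume "\<not> x u > 0"
    then have xu: "x u = 0" using x_ge[of u] by simp
    define Z where "Z = {w \<in> verts H. x w = 0}"
    have "\<exists>a\<in>verts H. x a \<noteq> 0"
    proof (rule ccontr)
      assume "\<not> ?thesis"
      then have "(\<Sum>u\<in>verts H. x u ^ r) = 0" using r by (intro sum.neutral) auto
      then show False using xnorm by simp
    qed
    then obtain a where a: "a \<in> verts H" "a \<notin> Z" by (auto simp: Z_def)
    have uZ: "u \<in> Z" using u xu by (simp add: Z_def)
    obtain e where e: "e \<in> edges H" "e \<inter> Z \<noteq> {}" "\<not> e \<subseteq> Z"
      using connected_cut_edge[OF conn a(1) u a(2) uZ] .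
    have finZ: "finite Z" using fin(1) by (simp add: Z_def)
    note fe = fin(5)[OF e(1)]
    define K where "K = fact r * (\<Prod>w\<in>e - Z. x w)"
    have K: "K > 0"
      unfolding K_def using fin(3)[OF e(1)] x_ge
      by (intro mult_pos_pos prod_pos) (auto simp: Z_def order_less_le)
    have key: "K \<le> \<rho> * real (card Z) * \<epsilon>" if eps: "0 < \<epsilon>" "\<epsilon> \<le> 1" for \<epsilon> :: real
    proof -
      define y where "y = (\<lambda>w. if w \<in> Z then \<epsilon> else x w)"
      have y_ge: "y w \<ge> 0" "x w \<le> y w" for w using x_ge eps by (auto simp: y_def Z_def)
      have "(\<Sum>w\<in>verts H. \<bar>y w\<bar> ^ r) = (\<Sum>w\<in>verts H. x w ^ r + (if w \<in> Z then \<epsilon> ^ r else 0))"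
        using x_ge eps r by (intro sum.cong) (auto simp: y_def Z_def)
      also have "\<dots> = 1 + (\<Sum>w\<in>verts H \<inter> Z. \<epsilon> ^ r)"
        by (simp only: sum.distrib xnorm sum.inter_restrict[OF fin(1)])
      also have "verts H \<inter> Z = Z" by (auto simp: Z_def)
      finally have ynorm: "(\<Sum>w\<in>verts H. \<bar>y w\<bar> ^ r) = 1 + real (card Z) * \<epsilon> ^ r" by simp
      have prod_e: "(\<Prod>w\<in>e. x w) = 0"
        using e(2) fe by (auto simp: prod_zero_iff Z_def)
      have split_e: "(\<Prod>w\<in>e. y w) = (\<Prod>w\<in>e - Z. x w) * \<epsilon> ^ card (e \<inter> Z)"
      proof -
        have "(\<Prod>w\<in>e. y w) = (\<Prod>w\<in>e - Z. y w) * (\<Prod>w\<in>e \<inter> Z. y w)"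
          by (subst prod.Int_Diff[OF fe, of _ Z]) (rule mult.commute)
        also have "(\<Prod>w\<in>e - Z. y w) = (\<Prod>w\<in>e - Z. x w)" by (intro prod.cong) (auto simp: y_def)
        also have "(\<Prod>w\<in>e \<inter> Z. y w) = (\<Prod>w\<in>e \<inter> Z. \<epsilon>)" by (intro prod.cong) (auto simp: y_def)
        finally show ?thesis by simp
      qed
      \<comment> \<open>\<open>e\<close> leaves \<open>Z\<close>, so at most \<open>r - 1\<close> of
        its factors equal \<open>\<epsilon>\<close>.\<close>
      have "card (e \<inter> Z) < card e" using e(3) fe by (intro psubset_card_mono) auto
      then have "card (e \<inter> Z) \<le> r - 1" using fin(4)[OF e(1)] by simp
      then have "\<epsilon> ^ (r - 1) \<le> \<epsilon> ^ card (e \<inter> Z)" using eps by (intro power_decreasing) auto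
      then have "(\<Prod>w\<in>e - Z. x w) * \<epsilon> ^ (r - 1) \<le> (\<Prod>w\<in>e. y w)"
        unfolding split_e using x_ge by (intro mult_left_mono prod_nonneg) auto
      then have "(\<Sum>f\<in>edges H. \<Prod>w\<in>f. x w) + (\<Prod>w\<in>e - Z. x w) * \<epsilon> ^ (r - 1)
          \<le> (\<Sum>f\<in>edges H - {e}. \<Prod>w\<in>f. y w) + (\<Prod>w\<in>e. y w)"
        unfolding sum.remove[OF fin(2) e(1)] prod_e using x_ge y_ge
        by (intro add_mono) (auto intro!: sum_mono prod_mono)
      also have "\<dots> = (\<Sum>f\<in>edges H. \<Prod>w\<in>f. y w)"
        by (simp add: sum.remove[OF fin(2) e(1)])
      finally have "fact r * ((\<Sum>f\<in>edges H. \<Prod>w\<in>f. x w) + (\<Prod>w\<in>e - Z. x w) * \<epsilon> ^ (r - 1))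
          \<le> fact r * (\<Sum>f\<in>edges H. \<Prod>w\<in>f. y w)"
        by (intro mult_left_mono) auto
      then have "\<rho> + K * \<epsilon> ^ (r - 1) \<le> poly_form r H y"
        using xform by (simp add: poly_form_def K_def algebra_simps)
      also have "\<dots> \<le> \<rho> * (1 + real (card Z) * \<epsilon> ^ r)"
        using poly_form_le_spectral_radius[OF H ne r, of y] ynorm by (simp add: \<rho>_def)
      finally have "K * \<epsilon> ^ (r - 1) \<le> (\<rho> * real (card Z) * \<epsilon>) * \<epsilon> ^ (r - 1)"
        using r by (simp add: algebra_simps power_eq_if[of _ r])
      then show ?thesis using eps by simp
    qed
    define B where "B = \<rho> * real (card Z)"
    \<comment> \<open>The choice \<open>\<epsilon> = 1\<close> makes \<open>K / (2 * B)\<close>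
      admissible as well; there the bound reads \<open>K \<le> K / 2\<close>.\<close>
    have "K \<le> B" using key[of 1] by (simp add: B_def)
    then have "B > 0" using K by simp
    have "K \<le> B * (K / (2 * B))"
      using key[of "K / (2 * B)"] K \<open>K \<le> B\<close> \<open>B > 0\<close> by (simp add: B_def)
    then show False using K \<open>B > 0\<close> by simp
  qed
  then show thesis using that xnorm xform \<rho>_def by blast
qed

text \<open>A Lagrange multiplier argument in a single coordinate: by homogeneity, the form minus
  \<open>\<rho>\<close> times the norm is at most 0 and equals 0 at the maximiser, so its derivative
  in each coordinate vanishes there.\<close>

lemma perron_vector:
  assumes H: "uniform_hypergraph r H" and conn: "connected_hypergraph H" and r: "r > 0"
  obtains x where "\<And>u. u \<in> verts H \<Longrightarrow> x u > 0"
    "\<And>u. u \<in> verts H \<Longrightarrow> local_form H x u = spectral_radius r H / fact (r - 1) * x u ^ r"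
proof -
  note fin = uniform_hypergraphD[OF H]
  have ne: "verts H \<noteq> {}" using conn by (simp add: connected_hypergraph_def)
  define \<rho> where "\<rho> = spectral_radius r H"
  obtain x where pos: "\<And>u. u \<in> verts H \<Longrightarrow> x u > 0" and norm: "(\<Sum>u\<in>verts H. x u ^ r) = 1"
    and form: "poly_form r H x = \<rho>"
    using positive_maximiser[OF H conn r] unfolding \<rho>_def by blast
  have "local_form H x u = \<rho> / fact (r - 1) * x u ^ r" if u: "u \<in> verts H" for u
  proof -
    \<comment> \<open>An edge contains \<open>u\<close> at most once, so the form is affine in the
      value \<open>t\<close> at \<open>u\<close>, with constant part \<open>C\<close> and slope
      \<open>K\<close>; \<open>N\<close> is the share of the norm on the other vertices.\<close>
    define C where "C = fact r * (\<Sum>e\<in>{e \<in> edges H. u \<notin> e}. \<Prod>w\<in>e. x w)"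
    define K where "K = fact r * (\<Sum>e\<in>{e \<in> edges H. u \<in> e}. \<Prod>w\<in>e - {u}. x w)"
    define N where "N = (\<Sum>w\<in>verts H - {u}. x w ^ r)"
    have form_upd: "poly_form r H (x(u := t)) = C + t * K" for t
    proof -
      have "(\<Sum>e\<in>edges H. \<Prod>w\<in>e. (x(u := t)) w)
          = (\<Sum>e\<in>{e \<in> edges H. u \<notin> e} \<union> {e \<in> edges H. u \<in> e}. \<Prod>w\<in>e. (x(u := t)) w)"
        by (intro sum.cong) auto
      also have "\<dots> = (\<Sum>e\<in>{e \<in> edges H. u \<notin> e}. \<Prod>w\<in>e. (x(u := t)) w)
          + (\<Sum>e\<in>{e \<in> edges H. u \<in> e}. \<Prod>w\<in>e. (x(u := t)) w)"
        using fin(2) by (intro sum.union_disjoint) auto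
      also have "(\<Sum>e\<in>{e \<in> edges H. u \<notin> e}. \<Prod>w\<in>e. (x(u := t)) w)
          = (\<Sum>e\<in>{e \<in> edges H. u \<notin> e}. \<Prod>w\<in>e. x w)"
        by (intro sum.cong prod.cong) auto
      also have "(\<Sum>e\<in>{e \<in> edges H. u \<in> e}. \<Prod>w\<in>e. (x(u := t)) w)
          = (\<Sum>e\<in>{e \<in> edges H. u \<in> e}. t * (\<Prod>w\<in>e - {u}. x w))"
      proof (intro sum.cong refl)
        fix e assume "e \<in> {e \<in> edges H. u \<in> e}"
        then have "(\<Prod>w\<in>e. (x(u := t)) w) = t * (\<Prod>w\<in>e - {u}. (x(u := t)) w)"
          using fin(5) by (subst prod.remove[of _ u]) auto
        also have "(\<Prod>w\<in>e - {u}. (x(u := t)) w) = (\<Prod>w\<in>e - {u}. x w)"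
          by (intro prod.cong) auto
        finally show "(\<Prod>w\<in>e. (x(u := t)) w) = t * (\<Prod>w\<in>e - {u}. x w)" .
      qed
      finally show ?thesis
        by (simp add: poly_form_def C_def K_def sum_distrib_left algebra_simps)
    qed
    have norm_upd: "(\<Sum>w\<in>verts H. \<bar>(x(u := t)) w\<bar> ^ r) = N + \<bar>t\<bar> ^ r" for t
    proof -
      have "(\<Sum>w\<in>verts H - {u}. \<bar>(x(u := t)) w\<bar> ^ r) = N"
        unfolding N_def using pos by (intro sum.cong) (auto simp: less_imp_le)
      then show ?thesis using sum.remove[OF fin(1) u, of "\<lambda>w. \<bar>(x(u := t)) w\<bar> ^ r"] by simp
    qed
    define g where "g = (\<lambda>t. C + t * K - \<rho> * (N + t ^ r))"
    have "g t \<le> 0" if "t > 0" for t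
      using poly_form_le_spectral_radius[OF H ne r, of "x(u := t)"] that
      by (simp add: g_def form_upd norm_upd del: fun_upd_apply flip: \<rho>_def)
    moreover have "g (x u) = 0"
      using form_upd[of "x u"] form sum.remove[OF fin(1) u, of "\<lambda>w. x w ^ r"] norm
      by (simp add: g_def N_def add.commute)
    \<comment> \<open>The radius \<open>x u\<close> keeps \<open>t\<close> positive, where
      \<open>\<bar>t\<bar> ^ r\<close> is \<open>t ^ r\<close>.\<close>
    ultimately have "\<forall>t. \<bar>x u - t\<bar> < x u \<longrightarrow> g t \<le> g (x u)" by auto
    moreover have "(g has_real_derivative (K - \<rho> * (real r * x u ^ (r - 1)))) (at (x u))"
      unfolding g_def by (auto intro!: derivative_eq_intros)
    ultimately have "K - \<rho> * (real r * x u ^ (r - 1)) = 0"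
      using DERIV_local_max[of g _ "x u" "x u"] pos[OF u] by blast
    then have "K = \<rho> * (real r * x u ^ (r - 1))" by simp
    then have "x u * K = \<rho> * real r * (x u * x u ^ (r - 1))" by (simp only: mult_ac)
    moreover have "x u * x u ^ (r - 1) = x u ^ r" using r by (simp add: power_eq_if)
    moreover have "x u * K = fact r * local_form H x u"
    proof -
      have "(\<Prod>w\<in>e. x w) = x u * (\<Prod>w\<in>e - {u}. x w)" if "e \<in> edges H" "u \<in> e" for e
        using that fin(5) by (subst prod.remove[of _ u]) auto
      then show ?thesis by (simp add: K_def local_form_def sum_distrib_left mult_ac)
    qed
    ultimately have "fact r * local_form H x u = \<rho> * real r * x u ^ r" by metis
    then have "real r * (fact (r - 1) * local_form H x u) = real r * (\<rho> * x u ^ r)"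
      using r by (simp only: fact_reduce[of r, where 'a = real] mult_ac)
    then show ?thesis using r by (simp add: field_simps)
  qed
  then show thesis using that pos \<rho>_def by blast
qed

section \<open>Coalescences\<close>

definition glue :: "'b \<Rightarrow> 'a \<Rightarrow> 'b \<Rightarrow> 'a + 'b" where
  "glue u v y = (if y = u then Inl v else Inr y)"

lemma glue_simps [simp]: "glue u v u = Inl v" "y \<noteq> u \<Longrightarrow> glue u v y = Inr y"
  by (simp_all add: glue_def)

lemma inj_glue: "inj (glue u v)"
  by (auto simp: inj_def glue_def split: if_splits)

lemma glue_mem_iff:
  "Inl a \<in> glue u v ` e \<longleftrightarrow> a = v \<and> u \<in> e" "p \<noteq> u \<Longrightarrow> Inr p \<in> glue u v ` e \<longleftrightarrow> p \<in> e"
  by (auto simp: glue_def image_iff)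

lemma coalesce_sel:
  "verts (coalesce H v G u) = Inl ` verts H \<union> glue u v ` verts G"
  "edges (coalesce H v G u) = (`) Inl ` edges H \<union> (`) (glue u v) ` edges G"
  by (simp_all add: coalesce_def Let_def glue_def[abs_def])

lemma uniform_coalesce:
  assumes "uniform_hypergraph r H" "uniform_hypergraph r G"
  shows "uniform_hypergraph r (coalesce H v G u)"
  using assms unfolding uniform_hypergraph_def coalesce_sel
  by (auto 0 3 simp: card_image inj_on_subset[OF inj_glue subset_UNIV])

lemma rtrancl_map_rel:
  assumes "\<And>x y. (x, y) \<in> R \<Longrightarrow> (f x, f y) \<in> S" "(a, b) \<in> R\<^sup>*"
  shows "(f a, f b) \<in> S\<^sup>*"
  using assms(2) by induction (auto intro: assms(1) rtrancl_into_rtrancl)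

text \<open>Every vertex is linked in both directions, within its own piece, to the shared vertex
  \<open>Inl v\<close>.\<close>

lemma connected_coalesce:
  assumes H: "connected_hypergraph H" and G: "connected_hypergraph G"
    and v: "v \<in> verts H" and u: "u \<in> verts G"
  shows "connected_hypergraph (coalesce H v G u)"
proof -
  let ?R = "{(a, b). \<exists>e\<in>edges (coalesce H v G u). a \<in> e \<and> b \<in> e}"
  have left: "(Inl a, Inl b) \<in> ?R\<^sup>*" if "a \<in> verts H" "b \<in> verts H" for a b
  proof -
    have "(a, b) \<in> {(a, b). \<exists>e\<in>edges H. a \<in> e \<and> b \<in> e}\<^sup>*"
      using H that by (simp add: connected_hypergraph_def)
    then show ?thesis by (rule rtrancl_map_rel[rotated]) (auto simp: coalesce_sel)
  qed
  have right: "(glue u v a, glue u v b) \<in> ?R\<^sup>*" if "a \<in> verts G" "b \<in> verts G" for a b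
  proof -
    have "(a, b) \<in> {(a, b). \<exists>e\<in>edges G. a \<in> e \<and> b \<in> e}\<^sup>*"
      using G that by (simp add: connected_hypergraph_def)
    then show ?thesis by (rule rtrancl_map_rel[rotated]) (auto simp: coalesce_sel)
  qed
  have "(p, Inl v) \<in> ?R\<^sup>* \<and> (Inl v, p) \<in> ?R\<^sup>*" if "p \<in> verts (coalesce H v G u)" for p
    using that left v right[OF _ u] right[OF u] unfolding coalesce_sel(1) by auto
  then have "\<forall>p\<in>verts (coalesce H v G u). \<forall>q\<in>verts (coalesce H v G u). (p, q) \<in> ?R\<^sup>*"
    by (meson rtrancl_trans)
  then show ?thesis using v by (auto simp: connected_hypergraph_def coalesce_sel(1))
qed

text \<open>\<open>Inr p\<close> lies in no edge coming from \<open>H\<close>, and gluing is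
  injective, so edges and products carry over from \<open>G\<close>.\<close>

lemma local_form_coalesce_Inr:
  assumes "p \<noteq> u"
  shows "local_form (coalesce H v G u) x (Inr p) = local_form G (\<lambda>y. x (glue u v y)) p"
proof -
  have "{e \<in> edges (coalesce H v G u). Inr p \<in> e}
      = {e \<in> (`) (glue u v) ` edges G. Inr p \<in> e}"
    by (auto simp: coalesce_sel(2))
  also have "\<dots> = (`) (glue u v) ` {e \<in> edges G. Inr p \<in> glue u v ` e}"
    by blast
  finally have "{e \<in> edges (coalesce H v G u). Inr p \<in> e}
      = (`) (glue u v) ` {e \<in> edges G. p \<in> e}"
    using assms by (simp add: glue_mem_iff)
  moreover have "inj_on ((`) (glue u v)) A" for A
    using inj_glue by (metis inj_image_eq_iff inj_onI)
  ultimately show ?thesis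
    by (simp add: local_form_def sum.reindex prod.reindex inj_on_subset[OF inj_glue subset_UNIV])
qed

text \<open>At the shared vertex both pieces contribute. Edges form a set, so an edge of
  \<open>G\<close> inside \<open>{u}\<close> could be glued onto an edge of \<open>H\<close> and be
  counted only once; \<open>no_loop\<close> rules this out.\<close>

lemma local_form_coalesce_Inl:
  fixes H :: "'a hypergraph" and G :: "'b hypergraph"
  assumes fin: "finite (edges H)" "finite (edges G)" and no_loop: "\<And>e. e \<in> edges G \<Longrightarrow> \<not> e \<subseteq> {u}"
  shows "local_form (coalesce H v G u) x (Inl a) = local_form H (\<lambda>y. x (Inl y)) a
     + (if a = v then local_form G (\<lambda>y. x (glue u v y)) u else 0)"
proof -
  define A :: "('a + 'b) set set" where "A = (`) Inl ` {e \<in> edges H. a \<in> e}"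
  define B where "B = (`) (glue u v) ` {e \<in> edges G. a = v \<and> u \<in> e}"
  have eq: "{e \<in> edges (coalesce H v G u). Inl a \<in> e} = A \<union> B"
  proof -
    have "{e \<in> f ` E \<union> g ` F. p \<in> e} = f ` {e \<in> E. p \<in> f e} \<union> g ` {e \<in> F. p \<in> g e}"
      for f :: "'a set \<Rightarrow> ('a + 'b) set" and g :: "'b set \<Rightarrow> ('a + 'b) set" and E F p
      by blast
    then show ?thesis
      by (simp only: coalesce_sel(2) glue_mem_iff inj_image_mem_iff[OF inj_Inl] A_def B_def)
  qed
  have disj: "A \<inter> B = {}"
  proof -
    have False if e: "e \<in> edges G" "glue u v ` e = Inl ` f" for e f
    proof -
      obtain p where "p \<in> e" "p \<noteq> u" using no_loop[OF e(1)] by blast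
      then have "Inr p \<in> (Inl ` f :: ('a + 'b) set)" using e(2) by (metis glue_simps(2) imageI)
      then show False by auto
    qed
    then show ?thesis unfolding A_def B_def by blast
  qed
  have "finite A" "finite B" using fin by (auto simp: A_def B_def)
  then have "local_form (coalesce H v G u) x (Inl a) = (\<Sum>e\<in>A. prod x e) + (\<Sum>e\<in>B. prod x e)"
    unfolding local_form_def eq using disj by (rule sum.union_disjoint)
  moreover have "inj_on ((`) (Inl :: 'a \<Rightarrow> 'a + 'b)) C" for C
    by (metis inj_Inl inj_image_eq_iff inj_onI)
  then have "(\<Sum>e\<in>A. prod x e) = local_form H (\<lambda>y. x (Inl y)) a"
    by (simp add: A_def local_form_def sum.reindex prod.reindex)
  moreover have "inj_on ((`) (glue u v)) C" for C
    using inj_glue by (metis inj_image_eq_iff inj_onI)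
  then have "(\<Sum>e\<in>B. prod x e) = (if a = v then local_form G (\<lambda>y. x (glue u v y)) u else 0)"
    by (simp add: B_def local_form_def sum.reindex prod.reindex inj_on_subset[OF inj_glue subset_UNIV])
  ultimately show ?thesis by simp
qed

section \<open>Hyperpaths\<close>

lemma path_edge_mem [simp]:
  "Spine j \<in> path_edge r i \<longleftrightarrow> j = i \<or> j = Suc i"
  "Extra a b \<in> path_edge r i \<longleftrightarrow> a = i \<and> b < r - 2"
  by (auto simp: path_edge_def)

lemma inj_path_edge: "inj_on (path_edge r) A"
proof (rule inj_onI)
  fix i j assume "path_edge r i = path_edge r j"
  then have "Spine i \<in> path_edge r j" "Spine j \<in> path_edge r i"
    using path_edge_mem(1) by metis+
  then show "i = j" by auto
qed

lemma prod_path_edge: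
  "prod z (path_edge r i) = z (Spine i) * z (Spine (Suc i)) * (\<Prod>j<r - 2. z (Extra i j))"
proof -
  have "prod z (path_edge r i) = prod z {Spine i, Spine (Suc i)} * prod z (Extra i ` {..<r - 2})"
    unfolding path_edge_def by (intro prod.union_disjoint) auto
  also have "prod z (Extra i ` {..<r - 2}) = (\<Prod>j<r - 2. z (Extra i j))"
    by (subst prod.reindex) (auto simp: inj_on_def)
  finally show ?thesis by simp
qed

lemma hyperpath_sel:
  "verts (hyperpath r k) = Spine ` {..k} \<union> {Extra i j |i j. i < k \<and> j < r - 2}"
  "edges (hyperpath r k) = path_edge r ` {..<k}"
  by (simp_all add: hyperpath_def)

lemma uniform_hyperpath:
  assumes "r \<ge> 2"
  shows "uniform_hypergraph r (hyperpath r k)"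
proof -
  have "card (path_edge r i) = r" for i
  proof -
    have "card (path_edge r i) = card {Spine i, Spine (Suc i)} + card (Extra i ` {..<r - 2})"
      unfolding path_edge_def by (intro card_Un_disjoint) auto
    also have "card (Extra i ` {..<r - 2}) = r - 2" by (subst card_image) (auto simp: inj_on_def)
    finally show ?thesis using assms by simp
  qed
  moreover have "{Extra i j |i j. i < k \<and> j < r - 2} = (\<lambda>(i, j). Extra i j) ` ({..<k} \<times> {..<r - 2})"
    by auto
  ultimately show ?thesis by (auto simp: uniform_hypergraph_def hyperpath_sel path_edge_def)
qed

lemma connected_hyperpath: "connected_hypergraph (hyperpath r k)"
proof -
  let ?R = "{(a, b). \<exists>e\<in>edges (hyperpath r k). a \<in> e \<and> b \<in> e}"
  have step: "(a, b) \<in> ?R" if "i < k" "a \<in> path_edge r i" "b \<in> path_edge r i" for a b i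
    using that by (auto simp: hyperpath_sel)
  have spine: "(Spine i, Spine 0) \<in> ?R\<^sup>*" if "i \<le> k" for i
    using that
  proof (induction i)
    case (Suc i)
    then have "(Spine (Suc i), Spine i) \<in> ?R" by (intro step[of i]) auto
    then show ?case using Suc by (simp add: converse_rtrancl_into_rtrancl)
  qed simp
  have "(Extra i j, Spine 0) \<in> ?R\<^sup>*" if "i < k" "j < r - 2" for i j
  proof -
    have "(Extra i j, Spine i) \<in> ?R" using that by (intro step[of i]) auto
    then show ?thesis using spine[of i] that by (simp add: converse_rtrancl_into_rtrancl)
  qed
  then have root: "(p, Spine 0) \<in> ?R\<^sup>*" if "p \<in> verts (hyperpath r k)" for p
    using that spine by (auto simp: hyperpath_sel(1))
  have "sym (?R\<^sup>*)" by (intro sym_rtrancl) (auto simp: sym_def)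
  then have "(p, q) \<in> ?R\<^sup>*" if "p \<in> verts (hyperpath r k)" "q \<in> verts (hyperpath r k)" for p q
    using root[OF that(1)] root[OF that(2)] by (meson rtrancl_trans symD)
  then show ?thesis by (auto simp: connected_hypergraph_def hyperpath_sel(1))
qed

lemma local_form_hyperpath:
  "local_form (hyperpath r m) z p = (\<Sum>i\<in>{i. i < m \<and> p \<in> path_edge r i}. prod z (path_edge r i))"
proof -
  have "{e \<in> edges (hyperpath r m). p \<in> e} = path_edge r ` {i. i < m \<and> p \<in> path_edge r i}"
    by (auto simp: hyperpath_sel)
  then show ?thesis by (simp add: local_form_def sum.reindex[OF inj_path_edge])
qed

lemma local_form_hyperpath_Extra:
  assumes "i < m" "j < r - 2"
  shows "local_form (hyperpath r m) z (Extra i j) = prod z (path_edge r i)"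
proof -
  have "{n. n < m \<and> Extra i j \<in> path_edge r n} = {i}" using assms by auto
  then show ?thesis by (simp add: local_form_hyperpath)
qed

text \<open>The boundary value 0 at index \<open>m + 1\<close> lets the end of the path, which lies
  in one edge only, and the path of length 0 follow the general formulas.\<close>

lemma local_form_hyperpath_Spine:
  assumes y: "\<And>i. i < m \<Longrightarrow> prod z (path_edge r i) = c * y i * y (Suc i)" and last: "y (Suc m) = (0::real)"
  shows "local_form (hyperpath r m) z (Spine 0) = c * y 0 * y 1"
    and "i < m \<Longrightarrow> local_form (hyperpath r m) z (Spine (Suc i)) = c * y (Suc i) * (y i + y (Suc (Suc i)))"
proof -
  have "{n. n < m \<and> Spine 0 \<in> path_edge r n} = (if m = 0 then {} else {0})" by auto
  then show "local_form (hyperpath r m) z (Spine 0) = c * y 0 * y 1"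
    using y last by (cases "m = 0") (simp_all add: local_form_hyperpath)
next
  assume i: "i < m"
  show "local_form (hyperpath r m) z (Spine (Suc i)) = c * y (Suc i) * (y i + y (Suc (Suc i)))"
  proof (cases "Suc i < m")
    case True
    then have "{n. n < m \<and> Spine (Suc i) \<in> path_edge r n} = {i, Suc i}" using i by auto
    then show ?thesis using y i True by (simp add: local_form_hyperpath algebra_simps)
  next
    case False
    then have "{n. n < m \<and> Spine (Suc i) \<in> path_edge r n} = {i}" "m = Suc i" using i by auto
    then show ?thesis using y[OF i] last by (simp add: local_form_hyperpath)
  qed
qed

section \<open>Chebyshev identities\<close>

text \<open>After the substitution \<open>y = x\<^bsup>r/2\<^esup>\<close> the eigenvalue equation along a hyperpath becomes that of an
  ordinary path, whose solutions are the Chebyshev polynomials of the second kind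
  (here shifted by one: \<open>cheb \<mu> n = U\<^sub>n\<^sub>-\<^sub>1 (\<mu>/2)\<close>).\<close>

fun cheb :: "real \<Rightarrow> nat \<Rightarrow> real" where
  "cheb \<mu> 0 = 0"
| "cheb \<mu> (Suc 0) = 1"
| "cheb \<mu> (Suc (Suc n)) = \<mu> * cheb \<mu> (Suc n) - cheb \<mu> n"

text \<open>Both sides satisfy the same three-term recurrence in \<open>n\<close> and agree at
  \<open>n = 0\<close> and \<open>n = 1\<close>.\<close>

lemma cheb_add:
  "cheb \<mu> (Suc (m + n)) = cheb \<mu> (Suc m) * cheb \<mu> (Suc n) - cheb \<mu> m * cheb \<mu> n"
proof (induction \<mu> n rule: cheb.induct)
  case (2 \<mu>)
  then show ?case by (cases m) auto
next
  case (3 \<mu> n)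
  have "cheb \<mu> (Suc (m + Suc (Suc n))) = \<mu> * cheb \<mu> (Suc (m + Suc n)) - cheb \<mu> (Suc (m + n))"
    by simp
  also have "\<dots> = \<mu> * (cheb \<mu> (Suc m) * cheb \<mu> (Suc (Suc n)) - cheb \<mu> m * cheb \<mu> (Suc n))
      - (cheb \<mu> (Suc m) * cheb \<mu> (Suc n) - cheb \<mu> m * cheb \<mu> n)"
    by (simp only: 3)
  also have "\<dots> = cheb \<mu> (Suc m) * cheb \<mu> (Suc (Suc (Suc n))) - cheb \<mu> m * cheb \<mu> (Suc (Suc n))"
    by (simp add: algebra_simps)
  finally show ?case .
qed simp

text \<open>The left side is an invariant of the recurrence, so its value at \<open>n = 0\<close>
  persists.\<close>

lemma cheb_quadratic:
  "(cheb \<mu> (Suc n))\<^sup>2 - \<mu> * cheb \<mu> n * cheb \<mu> (Suc n) + (cheb \<mu> n)\<^sup>2 = 1"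
  by (induction n) (simp_all add: power2_eq_square algebra_simps)

text \<open>Expressed through the values at \<open>k\<close>, \<open>Suc k\<close>, \<open>d\<close>
  and \<open>Suc d\<close>, the identity holds up to a factor on \<open>p * q\<close>, and that
  factor is the invariant of \<open>cheb_quadratic\<close>.\<close>

lemma cheb_product_diff:
  "cheb \<mu> (k + d) * cheb \<mu> (Suc (k + d)) - cheb \<mu> k * cheb \<mu> (Suc k)
     = cheb \<mu> d * cheb \<mu> (Suc (k + d + k))"
proof -
  define p q s t where "p = cheb \<mu> k" "q = cheb \<mu> (Suc k)" "s = cheb \<mu> d" "t = cheb \<mu> (Suc d)"
  note defs = this
  have B: "cheb \<mu> (Suc (k + d)) = q * t - p * s" by (simp add: cheb_add defs)
  \<comment> \<open>The addition formula is applied to the predecessor of \<open>k\<close>, where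
    the recurrence gives the value \<open>\<mu> * p - q\<close>.\<close>
  have A: "cheb \<mu> (k + d) = p * t - \<mu> * p * s + q * s"
  proof (cases k)
    case (Suc j)
    then show ?thesis using cheb_add[of \<mu> j d] by (simp add: defs algebra_simps)
  qed (simp add: defs)
  have 1: "t\<^sup>2 - \<mu> * s * t + s\<^sup>2 = 1" using cheb_quadratic[of \<mu> d] by (simp add: defs)
  have C: "cheb \<mu> (Suc (k + d + k)) = (q * t - p * s) * q - (p * t - \<mu> * p * s + q * s) * p"
    by (simp only: cheb_add[of \<mu> "k + d" k] A B flip: defs)
  have "(p * t - \<mu> * p * s + q * s) * (q * t - p * s) - p * q * (t\<^sup>2 - \<mu> * s * t + s\<^sup>2)
     = s * ((q * t - p * s) * q - (p * t - \<mu> * p * s + q * s) * p)"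
    by (simp add: algebra_simps power2_eq_square)
  then show ?thesis unfolding A B C defs(1-3)[symmetric] 1 by simp
qed

text \<open>This is \<open>t\<^sub>m\<close> of the overview, zero for \<open>m = 0\<close>. On an
  arm of length \<open>m\<close> it is the quotient of the substituted values \<open>y 1\<close> and
  \<open>y 0\<close>.\<close>

definition cheb_ratio :: "real \<Rightarrow> nat \<Rightarrow> real" where
  "cheb_ratio \<mu> m = cheb \<mu> m / cheb \<mu> (Suc m)"

text \<open>Over the common denominator the numerator is the invariant of
  \<open>cheb_quadratic\<close>.\<close>

lemma cheb_ratio_diff:
  assumes "cheb \<mu> (Suc n) \<noteq> 0" "cheb \<mu> (Suc (Suc n)) \<noteq> 0"
  shows "cheb_ratio \<mu> (Suc n) - cheb_ratio \<mu> n = 1 / (cheb \<mu> (Suc n) * cheb \<mu> (Suc (Suc n)))"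
proof -
  have "cheb_ratio \<mu> (Suc n) - cheb_ratio \<mu> n
     = ((cheb \<mu> (Suc n))\<^sup>2 - cheb \<mu> n * cheb \<mu> (Suc (Suc n))) / (cheb \<mu> (Suc n) * cheb \<mu> (Suc (Suc n)))"
    using assms by (simp add: cheb_ratio_def power2_eq_square diff_divide_eq_iff divide_diff_eq_iff
        mult_ac del: cheb.simps)
  also have "(cheb \<mu> (Suc n))\<^sup>2 - cheb \<mu> n * cheb \<mu> (Suc (Suc n)) = 1"
    using cheb_quadratic[of \<mu> n] by (simp add: power2_eq_square algebra_simps)
  finally show ?thesis .
qed

text \<open>The bound by \<open>\<mu>\<close> amounts to positivity of \<open>cheb\<close> at index
  \<open>k + l + 2\<close>, which lies beyond the range of \<open>pos\<close>. By
  \<open>cheb_product_diff\<close> the ratio then grows more from \<open>k - 1\<close> to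
  \<open>k\<close> than from \<open>l\<close> to \<open>l + 1\<close>.\<close>

lemma cheb_ratio_balance:
  assumes pos: "\<And>j. 1 \<le> j \<Longrightarrow> j \<le> l + 2 \<Longrightarrow> cheb \<mu> j > 0" and k: "1 \<le> k" "k \<le> l"
    and \<mu>: "cheb_ratio \<mu> (k - 1) + cheb_ratio \<mu> (l + 1) < \<mu>"
  shows "cheb_ratio \<mu> (k - 1) + cheb_ratio \<mu> (l + 1) < cheb_ratio \<mu> k + cheb_ratio \<mu> l"
proof -
  obtain i where i: "k = Suc i" using k by (cases k) auto
  \<comment> \<open>The shift by \<open>d\<close> takes the indices \<open>k\<close>,
    \<open>k + 1\<close> to \<open>l + 1\<close>, \<open>l + 2\<close>.\<close>
  define d where "d = l + 1 - k"
  have d: "k + d = l + 1" "1 \<le> d" "d \<le> l" using k by (auto simp: d_def)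
  define K0 K1 K2 L1 L2 where
    "K0 = cheb \<mu> i" "K1 = cheb \<mu> k" "K2 = cheb \<mu> (Suc k)"
    "L1 = cheb \<mu> (Suc l)" "L2 = cheb \<mu> (Suc (Suc l))"
  note defs = this
  have p: "K1 > 0" "K2 > 0" "L1 > 0" "L2 > 0"
    using pos k by (auto simp: defs simp del: cheb.simps)
  have "K0 / K1 + L1 / L2 < \<mu>" using \<mu> by (simp add: defs i cheb_ratio_def del: cheb.simps)
  then have "K0 * L2 + L1 * K1 < \<mu> * (K1 * L2)"
    using p by (simp add: add_frac_eq divide_less_eq)
  moreover have "K2 = \<mu> * K1 - K0" by (simp add: defs i)
  then have "L2 * K2 = \<mu> * (K1 * L2) - K0 * L2" by (simp only: ring_distribs mult_ac)
  ultimately have "L2 * K2 - L1 * K1 > 0" by linarith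
  then have "cheb \<mu> (Suc (l + 1 + k)) > 0"
    unfolding cheb_add[of \<mu> "l + 1" k] by (simp add: defs del: cheb.simps)
  moreover have "cheb \<mu> d > 0" using d by (intro pos) auto
  moreover have "L1 * L2 - K1 * K2 = cheb \<mu> d * cheb \<mu> (Suc (l + 1 + k))"
    using cheb_product_diff[of \<mu> k d] by (simp add: d(1) defs del: cheb.simps)
  ultimately have "K1 * K2 < L1 * L2" by (smt (verit) mult_pos_pos)
  then have "1 / (L1 * L2) < 1 / (K1 * K2)" using p by (simp add: frac_less2)
  moreover have "cheb_ratio \<mu> k - cheb_ratio \<mu> (k - 1) = 1 / (K1 * K2)"
    using cheb_ratio_diff[of \<mu> i] p by (simp add: defs i del: cheb.simps)
  moreover have "cheb_ratio \<mu> (l + 1) - cheb_ratio \<mu> l = 1 / (L1 * L2)"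
    using cheb_ratio_diff[of \<mu> l] p by (simp add: defs del: cheb.simps)
  ultimately show ?thesis by simp
qed

section \<open>Eigenvectors on hyperpaths\<close>

lemma power2_mult_power:
  fixes x :: real
  shows "2 \<le> r \<Longrightarrow> x\<^sup>2 * x ^ (r - 2) = x ^ r"
  by (metis le_add_diff_inverse power_add)

lemma sqrt_power_squared: "0 \<le> x \<Longrightarrow> (sqrt x ^ r)\<^sup>2 = x ^ r"
  by (simp flip: real_sqrt_power)

text \<open>The square root is the only possible common positive value at the added vertices:
  equating \<open>lam * \<epsilon> ^ r\<close> with an edge product having \<open>r - 2\<close>
  factors \<open>\<epsilon>\<close> determines \<open>\<epsilon>\<^sup>2\<close>. The second form is
  bilinear in the substituted spine values.\<close>

lemma prod_path_edge_eigen: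
  assumes lam: "lam > 0" and r: "r \<ge> 2" and z: "z (Spine i) > 0" "z (Spine (Suc i)) > 0"
    and e: "\<And>j. j < r - 2 \<Longrightarrow> z (Extra i j) = sqrt (z (Spine i) * z (Spine (Suc i)) / lam)"
  shows "prod z (path_edge r i) = lam * sqrt (z (Spine i) * z (Spine (Suc i)) / lam) ^ r"
    and "prod z (path_edge r i)
      = lam / sqrt lam ^ r * sqrt (z (Spine i)) ^ r * sqrt (z (Spine (Suc i))) ^ r"
proof -
  define \<epsilon> where "\<epsilon> = sqrt (z (Spine i) * z (Spine (Suc i)) / lam)"
  have "prod z (path_edge r i) = z (Spine i) * z (Spine (Suc i)) * \<epsilon> ^ (r - 2)"
    using e by (simp add: prod_path_edge \<epsilon>_def)
  also have "z (Spine i) * z (Spine (Suc i)) = lam * \<epsilon>\<^sup>2"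
    using lam z by (simp add: \<epsilon>_def)
  also have "lam * \<epsilon>\<^sup>2 * \<epsilon> ^ (r - 2) = lam * \<epsilon> ^ r"
    by (simp only: mult.assoc power2_mult_power[OF r])
  finally show 1: "prod z (path_edge r i) = lam * sqrt (z (Spine i) * z (Spine (Suc i)) / lam) ^ r"
    by (simp add: \<epsilon>_def)
  show "prod z (path_edge r i)
      = lam / sqrt lam ^ r * sqrt (z (Spine i)) ^ r * sqrt (z (Spine (Suc i))) ^ r"
    unfolding 1 by (simp add: real_sqrt_divide real_sqrt_mult power_divide power_mult_distrib)
qed

text \<open>Solved from the free end, the recurrence starts with 0 and \<open>y m\<close>, so
  \<open>y\<close> is \<open>y m\<close> times the Chebyshev sequence read backwards. Its positivity
  gives that of \<open>cheb\<close>, and its two values nearest the root give the local form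
  there.\<close>

lemma hyperpath_eigenvector_cheb:
  assumes lam: "lam > 0" and r: "r \<ge> 2"
    and pos: "\<And>p. p \<in> verts (hyperpath r m) \<Longrightarrow> z p > 0"
    and eig: "\<And>p. p \<in> verts (hyperpath r m) \<Longrightarrow> p \<noteq> Spine 0 \<Longrightarrow>
      local_form (hyperpath r m) z p = lam * z p ^ r"
  defines "\<mu> \<equiv> sqrt lam ^ r"
  shows "\<And>j. 1 \<le> j \<Longrightarrow> j \<le> Suc m \<Longrightarrow> cheb \<mu> j > 0"
    and "local_form (hyperpath r m) z (Spine 0) = lam / \<mu> * z (Spine 0) ^ r * cheb_ratio \<mu> m"
proof -
  define y where "y = (\<lambda>i. if i \<le> m then sqrt (z (Spine i)) ^ r else 0)"
  have \<mu>: "\<mu> > 0" using lam by (simp add: \<mu>_def)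
  have spine: "z (Spine i) > 0" if "i \<le> m" for i using pos that by (simp add: hyperpath_sel)
  have y_pos: "y i > 0" and y_sq: "(y i)\<^sup>2 = z (Spine i) ^ r" if "i \<le> m" for i
    using spine[OF that] that by (simp_all add: y_def sqrt_power_squared)
  have edge: "prod z (path_edge r i) = lam / \<mu> * y i * y (Suc i)" if i: "i < m" for i
  proof -
    \<comment> \<open>All added vertices of an edge have the edge product as local form, so this
      root is their common value.\<close>
    define \<epsilon> where "\<epsilon> = root r (prod z (path_edge r i) / lam)"
    have P: "prod z (path_edge r i) > 0"
      using i by (intro prod_pos ballI pos) (auto simp: path_edge_def hyperpath_sel)
    have \<epsilon>: "\<epsilon> > 0" "lam * \<epsilon> ^ r = prod z (path_edge r i)" using P lam r by (auto simp: \<epsilon>_def)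
    have extra: "z (Extra i j) = \<epsilon>" if j: "j < r - 2" for j
    proof -
      have v: "Extra i j \<in> verts (hyperpath r m)" using i j by (auto simp: hyperpath_sel)
      then have "lam * z (Extra i j) ^ r = local_form (hyperpath r m) z (Extra i j)"
        using eig[OF v] by simp
      also have "\<dots> = prod z (path_edge r i)" by (rule local_form_hyperpath_Extra[OF i j])
      also have "\<dots> = lam * \<epsilon> ^ r" by (rule \<epsilon>(2)[symmetric])
      finally have "z (Extra i j) ^ r = \<epsilon> ^ r" using lam by simp
      then show ?thesis
        by (rule power_eq_imp_eq_base) (use \<epsilon>(1) pos[OF v] r in linarith)+
    qed
    have "lam * \<epsilon>\<^sup>2 * \<epsilon> ^ (r - 2) = lam * \<epsilon> ^ r"
      by (simp only: mult.assoc power2_mult_power[OF r])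
    also have "\<dots> = z (Spine i) * z (Spine (Suc i)) * \<epsilon> ^ (r - 2)"
      unfolding \<epsilon>(2) using extra by (simp add: prod_path_edge)
    finally have "\<epsilon>\<^sup>2 = z (Spine i) * z (Spine (Suc i)) / lam"
      using \<epsilon>(1) lam by (simp add: field_simps)
    then have "\<epsilon> = sqrt (z (Spine i) * z (Spine (Suc i)) / lam)"
      using \<epsilon>(1) by (metis less_imp_le real_sqrt_unique)
    then show ?thesis
      using prod_path_edge_eigen(2)[OF lam r, of z i] extra spine[of i] spine[of "Suc i"] i
      by (simp add: y_def \<mu>_def)
  qed
  note local_forms = local_form_hyperpath_Spine[of m z r "lam / \<mu>" y, OF edge]
  have rec: "\<mu> * y (Suc i) = y i + y (Suc (Suc i))" if i: "i < m" for i
  proof -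
    have "lam / \<mu> * y (Suc i) * (y i + y (Suc (Suc i))) = lam * (y (Suc i))\<^sup>2"
      using local_forms(2)[of i] eig[of "Spine (Suc i)"] i y_sq[of "Suc i"]
      by (simp add: hyperpath_sel) (simp add: y_def)
    then have "lam * y (Suc i) * (y i + y (Suc (Suc i))) = lam * y (Suc i) * (\<mu> * y (Suc i))"
      using \<mu> by (simp add: power2_eq_square field_simps)
    moreover have "lam * y (Suc i) \<noteq> 0" using lam y_pos[of "Suc i"] i by simp
    ultimately show ?thesis by (metis mult_left_cancel)
  qed
  \<comment> \<open>\<open>j\<close> counts from the free end; two consecutive values are carried
    because the recurrence has order two.\<close>
  have "y (Suc m - j) = y m * cheb \<mu> j \<and> y (m - j) = y m * cheb \<mu> (Suc j)" if "j \<le> m" for j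
    using that
  proof (induction j)
    case 0
    then show ?case by (simp add: y_def)
  next
    case (Suc j)
    then have idx: "Suc (m - Suc j) = m - j" "Suc (m - j) = Suc m - j" by auto
    have "y (m - Suc j) = \<mu> * y (m - j) - y (Suc m - j)"
      using rec[of "m - Suc j"] Suc.prems unfolding idx by simp
    then show ?case using Suc by (simp add: algebra_simps)
  qed
  then have y_cheb: "y (m - j) = y m * cheb \<mu> (Suc j)" if "j \<le> m" for j using that by blast
  show cheb_pos: "cheb \<mu> j > 0" if "1 \<le> j" "j \<le> Suc m" for j
  proof -
    have "y m * cheb \<mu> j > 0" using y_cheb[of "j - 1"] y_pos[of "m - (j - 1)"] that by simp
    then show ?thesis using y_pos[of m] by (simp add: zero_less_mult_iff)
  qed
  have "y 0 = y m * cheb \<mu> (Suc m)" using y_cheb[of m] by simp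
  moreover have "y 1 = y m * cheb \<mu> m"
    using y_cheb[of "m - 1"] by (cases m) (simp_all add: y_def)
  ultimately have "y 1 = y 0 * cheb_ratio \<mu> m"
    using cheb_pos[of "Suc m"] by (simp add: cheb_ratio_def del: cheb.simps)
  then show "local_form (hyperpath r m) z (Spine 0) = lam / \<mu> * z (Spine 0) ^ r * cheb_ratio \<mu> m"
    using local_forms(1) y_sq[of 0] by (simp add: y_def power2_eq_square mult.assoc)
qed

text \<open>Converse of \<open>hyperpath_eigenvector_cheb\<close>: the backward Chebyshev sequence
  solves the recurrence, and positivity of \<open>cheb\<close> makes the vector positive. Arms can
  thus change length while \<open>lam\<close> and the root value stay fixed.\<close>

lemma hyperpath_eigenvector_exists:
  assumes lam: "lam > 0" and r: "r \<ge> 2" and a: "a > 0"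
  defines "\<mu> \<equiv> sqrt lam ^ r"
  assumes cheb_pos: "\<And>j. 1 \<le> j \<Longrightarrow> j \<le> Suc m \<Longrightarrow> cheb \<mu> j > 0"
  obtains z where "\<And>p. z p > 0" "z (Spine 0) = a"
    "\<And>p. p \<in> verts (hyperpath r m) \<Longrightarrow> p \<noteq> Spine 0 \<Longrightarrow>
      local_form (hyperpath r m) z p = lam * z p ^ r"
    "local_form (hyperpath r m) z (Spine 0) = lam / \<mu> * a ^ r * cheb_ratio \<mu> m"
proof -
  \<comment> \<open>The scaling makes \<open>y 0\<close> equal \<open>sqrt a ^ r\<close>, and
    \<open>y (Suc m)\<close> vanishes because \<open>cheb \<mu> 0 = 0\<close>.\<close>
  define y where "y = (\<lambda>i. sqrt a ^ r * cheb \<mu> (Suc m - i) / cheb \<mu> (Suc m))"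
  \<comment> \<open>The root undoes the substitution; the default 1 keeps \<open>z\<close> positive
    off the path too.\<close>
  define s where "s = (\<lambda>i. if i \<le> m then root r ((y i)\<^sup>2) else 1)"
  define z where "z = case_path_vertex s (\<lambda>i j. sqrt (s i * s (Suc i) / lam))"
  have \<mu>: "\<mu> > 0" using lam by (simp add: \<mu>_def)
  have y_pos: "y i > 0" if "i \<le> m" for i
    using that a cheb_pos[of "Suc m - i"] cheb_pos[of "Suc m"]
    by (simp add: y_def Suc_diff_le del: cheb.simps)
  have s_pos: "s i > 0" for i using y_pos[of i] r by (auto simp: s_def)
  have z_pos: "z p > 0" for p using s_pos lam by (cases p) (auto simp: z_def)
  have s_pow: "s i ^ r = (y i)\<^sup>2" if "i \<le> m" for i using that r by (simp add: s_def)
  have s_y: "sqrt (s i) ^ r = y i" if "i \<le> m" for i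
    using s_pow[OF that] y_pos[OF that] by (simp flip: real_sqrt_power)
  have y0: "y 0 = sqrt a ^ r" using cheb_pos[of "Suc m"] by (simp add: y_def del: cheb.simps)
  then have y0_sq: "(y 0)\<^sup>2 = a ^ r" using a by (simp add: sqrt_power_squared)
  have z0: "z (Spine 0) = a" using y0_sq a r by (simp add: z_def s_def real_root_power_cancel)
  have edge: "prod z (path_edge r i) = lam * sqrt (s i * s (Suc i) / lam) ^ r"
    "prod z (path_edge r i) = lam / \<mu> * y i * y (Suc i)" if i: "i < m" for i
    using prod_path_edge_eigen[OF lam r, of z i] s_pos s_y[of i] s_y[of "Suc i"] i
    by (simp_all add: z_def \<mu>_def)
  have "y (Suc m) = 0" by (simp add: y_def)
  note local_forms = local_form_hyperpath_Spine[of m z r "lam / \<mu>" y, OF edge(2) this]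
  have eig: "local_form (hyperpath r m) z p = lam * z p ^ r"
    if p: "p \<in> verts (hyperpath r m)" "p \<noteq> Spine 0" for p
  proof (cases p)
    case (Spine n)
    then obtain i where i: "n = Suc i" "i < m" using p by (cases n) (auto simp: hyperpath_sel)
    then have idx: "Suc m - i = Suc (Suc (m - Suc i))" "Suc m - Suc i = Suc (m - Suc i)"
      "Suc m - Suc (Suc i) = m - Suc i" by auto
    have "y i + y (Suc (Suc i)) = \<mu> * y (Suc i)"
      unfolding y_def idx by (simp add: algebra_simps add_divide_distrib[symmetric])
    then have "local_form (hyperpath r m) z p = lam * (y (Suc i))\<^sup>2"
      using local_forms(2)[OF _ i(2)] \<mu> by (simp add: Spine i power2_eq_square)
    then show ?thesis using s_pow[of "Suc i"] i by (simp add: Spine z_def)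
  next
    case (Extra i j)
    then have ij: "i < m" "j < r - 2" using p by (auto simp: hyperpath_sel)
    show ?thesis
      using local_form_hyperpath_Extra[OF ij, of z] edge(1)[OF ij(1)] by (simp add: Extra z_def)
  qed
  have "y 1 = y 0 * cheb_ratio \<mu> m"
    by (simp add: y0 cheb_ratio_def) (simp add: y_def)
  then have "local_form (hyperpath r m) z (Spine 0) = lam / \<mu> * a ^ r * cheb_ratio \<mu> m"
    using local_forms(1) y0_sq by (simp add: power2_eq_square mult.assoc)
  then show thesis using that z_pos z0 eig by blast
qed

section \<open>Attaching two paths\<close>

lemma attach_two_paths_hypergraph:
  assumes "r \<ge> 2" "uniform_hypergraph r H"
  shows "uniform_hypergraph r (attach_two_paths r k l H v)"
    and "connected_hypergraph H \<Longrightarrow> v \<in> verts H \<Longrightarrow> connected_hypergraph (attach_two_paths r k l H v)"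
  unfolding attach_two_paths_def attach_path_def using assms
  by (intro uniform_coalesce connected_coalesce uniform_hyperpath connected_hyperpath;
      auto simp: coalesce_sel hyperpath_sel)+

lemma verts_attach_two_paths:
  assumes "v \<in> verts H"
  shows "verts (attach_two_paths r k l H v) = (\<lambda>u. Inl (Inl u)) ` verts H
     \<union> (\<lambda>p. Inl (Inr p)) ` (verts (hyperpath r k) - {Spine 0})
     \<union> Inr ` (verts (hyperpath r l) - {Spine 0})"
proof -
  have glue_verts: "glue (Spine 0) u ` verts (hyperpath r m)
      = insert (Inl u) (Inr ` (verts (hyperpath r m) - {Spine 0}))" for u :: 'c and m
    by (auto simp: glue_def image_iff hyperpath_sel)
  show ?thesis
    using assms unfolding attach_two_paths_def attach_path_def coalesce_sel glue_verts
    by (auto simp: image_Un image_image)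
qed

text \<open>Only the shared vertex lies in more than one piece, so only there do local forms add up.
  \<open>x1\<close> and \<open>x2\<close> read \<open>x\<close> along the arms, with the root taken
  to \<open>v\<close>.\<close>

lemma local_form_attach_two_paths:
  fixes x :: "('a + path_vertex) + path_vertex \<Rightarrow> real" and k l :: nat and v :: 'a
  assumes H: "uniform_hypergraph r H" and r: "r \<ge> 2"
  defines "G \<equiv> attach_two_paths r k l H v"
    and "x1 \<equiv> \<lambda>p. x (Inl (glue (Spine 0) v p))" and "x2 \<equiv> \<lambda>p. x (glue (Spine 0) (Inl v) p)"
  shows "local_form G x (Inl (Inl u)) = local_form H (\<lambda>w. x (Inl (Inl w))) u
      + (if u = v then local_form (hyperpath r k) x1 (Spine 0)
                     + local_form (hyperpath r l) x2 (Spine 0) else 0)"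
    and "p \<noteq> Spine 0 \<Longrightarrow> local_form G x (Inl (Inr p)) = local_form (hyperpath r k) x1 p"
    and "p \<noteq> Spine 0 \<Longrightarrow> local_form G x (Inr p) = local_form (hyperpath r l) x2 p"
proof -
  have no_loop: "\<not> e \<subseteq> {Spine 0}" if "e \<in> edges (hyperpath r m)" for e m
    using that path_edge_mem(1)[of "Suc _"] by (force simp: hyperpath_sel)
  note fin = uniform_hypergraphD(2)[OF H] uniform_hypergraphD(2)[OF uniform_hyperpath[OF r]]
    uniform_hypergraphD(2)[OF uniform_coalesce[OF H uniform_hyperpath[OF r]]]
  note simps = G_def attach_two_paths_def attach_path_def x1_def x2_def
    local_form_coalesce_Inl[OF fin(1) fin(2) no_loop] local_form_coalesce_Inl[OF fin(3) fin(2) no_loop]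
    local_form_coalesce_Inr
  show "local_form G x (Inl (Inl u)) = local_form H (\<lambda>w. x (Inl (Inl w))) u
      + (if u = v then local_form (hyperpath r k) x1 (Spine 0)
                     + local_form (hyperpath r l) x2 (Spine 0) else 0)"
    and "p \<noteq> Spine 0 \<Longrightarrow> local_form G x (Inl (Inr p)) = local_form (hyperpath r k) x1 p"
    and "p \<noteq> Spine 0 \<Longrightarrow> local_form G x (Inr p) = local_form (hyperpath r l) x2 p"
    by (simp_all add: simps)
qed

section \<open>Comparison of the two graphs\<close>

theorem theorem3p2:
  fixes H :: "'a hypergraph" and v :: 'a and r k l :: nat
  assumes "r \<ge> 3"
    and "uniform_hypergraph r H"
    and "connected_hypergraph H"
    and "edges H \<noteq> {}"
    and "v \<in> verts H"
    and "1 \<le> k" and "k \<le> l"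
  shows "spectral_radius r (attach_two_paths r k l H v)
       > spectral_radius r (attach_two_paths r (k - 1) (l + 1) H v)"
proof -
  note H = assms(2) and conn = assms(3) and v = assms(5)
  have r: "r \<ge> 2" "r > 0" using assms(1) by auto
  define G' where "G' = attach_two_paths r (k - 1) (l + 1) H v"
  define G where "G = attach_two_paths r k l H v"
  note G' = attach_two_paths_hypergraph[OF r(1) H, where k = "k - 1" and l = "l + 1" and v = v, folded G'_def]
  note verts_G' = verts_attach_two_paths[OF v, where r = r and k = "k - 1" and l = "l + 1", folded G'_def]
  note verts_G = verts_attach_two_paths[OF v, where r = r and k = k and l = l, folded G_def]
  note form_G' = local_form_attach_two_paths[OF H r(1), where k = "k - 1" and l = "l + 1" and v = v, folded G'_def]
  note form_G = local_form_attach_two_paths[OF H r(1), where k = k and l = l and v = v, folded G_def]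
  define lam where "lam = spectral_radius r G' / fact (r - 1)"
  obtain x where pos: "\<And>u. u \<in> verts G' \<Longrightarrow> x u > 0"
    and eig: "\<And>u. u \<in> verts G' \<Longrightarrow> local_form G' x u = lam * x u ^ r"
    using perron_vector[OF G'(1) G'(2)[OF conn v] r(2)] unfolding lam_def by blast
  define xH where "xH = (\<lambda>w. x (Inl (Inl w)))"
  define x1 where "x1 = (\<lambda>p. x (Inl (glue (Spine 0) v p)))"
  define x2 where "x2 = (\<lambda>p. x (glue (Spine 0) (Inl v) p))"
  note form_x = form_G'[where x = x, folded xH_def x1_def x2_def]
  have root: "x1 (Spine 0) = xH v" "x2 (Spine 0) = xH v" by (simp_all add: x1_def x2_def xH_def)
  have xH_pos: "xH u > 0" if "u \<in> verts H" for u
    using pos that unfolding xH_def verts_G' by blast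
  have arm1: "x1 p > 0" "p \<noteq> Spine 0 \<Longrightarrow> local_form (hyperpath r (k - 1)) x1 p = lam * x1 p ^ r"
    if "p \<in> verts (hyperpath r (k - 1))" for p
  proof -
    have "p \<noteq> Spine 0 \<Longrightarrow> Inl (Inr p) \<in> verts G'" using that unfolding verts_G' by blast
    then show "x1 p > 0" "p \<noteq> Spine 0 \<Longrightarrow> local_form (hyperpath r (k - 1)) x1 p = lam * x1 p ^ r"
      using pos eig form_x(2)[of p] xH_pos[OF v] root(1)
      by (cases "p = Spine 0"; force simp: x1_def)+
  qed
  have arm2: "x2 p > 0" "p \<noteq> Spine 0 \<Longrightarrow> local_form (hyperpath r (l + 1)) x2 p = lam * x2 p ^ r"
    if "p \<in> verts (hyperpath r (l + 1))" for p
  proof -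
    have "p \<noteq> Spine 0 \<Longrightarrow> Inr p \<in> verts G'" using that unfolding verts_G' by blast
    then show "x2 p > 0" "p \<noteq> Spine 0 \<Longrightarrow> local_form (hyperpath r (l + 1)) x2 p = lam * x2 p ^ r"
      using pos eig form_x(3)[of p] xH_pos[OF v] root(2)
      by (cases "p = Spine 0"; force simp: x2_def)+
  qed
  \<comment> \<open>An edge has at least three vertices, so some vertex differs from
    \<open>v\<close>, and connectivity yields an edge of \<open>H\<close> at
    \<open>v\<close>.\<close>
  have form_H: "local_form H xH v > 0"
  proof -
    obtain e where e: "e \<in> edges H" using assms(4) by blast
    have "\<not> e \<subseteq> {v}"
      using uniform_hypergraphD(4)[OF H e] assms(1) card_mono[of "{v}" e] by auto
    then obtain w where w: "w \<in> verts H" "w \<notin> {v}" using uniform_hypergraphD(3)[OF H e] by blast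
    obtain f where f: "f \<in> edges H" "f \<inter> {v} \<noteq> {}"
      using connected_cut_edge[OF conn w(1) v w(2) singletonI] by metis
    have "(\<Prod>u\<in>g. xH u) > 0" if "g \<in> edges H" for g
      using uniform_hypergraphD(3)[OF H that] xH_pos by (intro prod_pos) blast
    then show ?thesis
      unfolding local_form_def using uniform_hypergraphD(2)[OF H] f by (intro sum_pos) auto
  qed
  define L1 L2 where "L1 = local_form (hyperpath r (k - 1)) x1 (Spine 0)"
    and "L2 = local_form (hyperpath r (l + 1)) x2 (Spine 0)"
  have at_v: "local_form H xH v + (L1 + L2) = lam * xH v ^ r"
    using form_x(1)[of v] eig[of "Inl (Inl v)"] v unfolding verts_G' by (simp add: L1_def L2_def xH_def)
  \<comment> \<open>In the equation at \<open>v\<close> the term from \<open>H\<close> is positive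
    and the arms contribute nonnegative terms.\<close>
  have lam: "lam > 0"
  proof -
    have nonneg: "local_form (hyperpath r m) y (Spine 0) \<ge> 0"
      if "\<And>p. p \<in> verts (hyperpath r m) \<Longrightarrow> y p > 0" for y m
    proof -
      have "(\<Prod>w\<in>e. y w) \<ge> 0" if "e \<in> edges (hyperpath r m)" for e
        using uniform_hypergraphD(3)[OF uniform_hyperpath[OF r(1)] that]
          \<open>\<And>p. p \<in> verts (hyperpath r m) \<Longrightarrow> y p > 0\<close>
        by (intro prod_nonneg) (meson less_imp_le subsetD)
      then show ?thesis unfolding local_form_def by (intro sum_nonneg) blast
    qed
    have "L1 \<ge> 0" "L2 \<ge> 0"
      unfolding L1_def L2_def using nonneg[OF arm1(1)] nonneg[OF arm2(1)] by simp_all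
    then have "lam * xH v ^ r > 0" using at_v form_H by linarith
    then show ?thesis using xH_pos[OF v] by (simp add: zero_less_mult_iff)
  qed
  define \<mu> where "\<mu> = sqrt lam ^ r"
  have \<mu>: "\<mu> > 0" using lam by (simp add: \<mu>_def)
  note cheb1 = hyperpath_eigenvector_cheb[OF lam r(1) arm1, folded \<mu>_def L1_def, unfolded root]
  note cheb2 = hyperpath_eigenvector_cheb[OF lam r(1) arm2, folded \<mu>_def L2_def, unfolded root]
  \<comment> \<open>The long arm has length \<open>l + 1\<close>, so its positivity range covers
    both new arms, of lengths \<open>k\<close> and \<open>l\<close>.\<close>
  have cheb_pos: "cheb \<mu> j > 0" if "1 \<le> j" "j \<le> l + 2" for j using cheb2(1) that by simp
  have cheb_pos_le: "cheb \<mu> j > 0" if "m \<le> l" "1 \<le> j" "j \<le> Suc m" for m j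
    using that by (intro cheb_pos) auto
  \<comment> \<open>Both arms start from the same value at \<open>v\<close>, so their root terms are
    \<open>c\<close> times their ratios.\<close>
  define c where "c = lam / \<mu> * xH v ^ r"
  have c: "c > 0" "lam * xH v ^ r = c * \<mu>" using lam \<mu> xH_pos[OF v] by (simp_all add: c_def)
  have L: "L1 + L2 = c * (cheb_ratio \<mu> (k - 1) + cheb_ratio \<mu> (l + 1))"
    using cheb1(2) cheb2(2) by (simp add: c_def algebra_simps)
  \<comment> \<open>Dropping the positive term of \<open>H\<close> from the equation at
    \<open>v\<close> gives the strict bound.\<close>
  have "c * (cheb_ratio \<mu> (k - 1) + cheb_ratio \<mu> (l + 1)) < c * \<mu>"
    using at_v form_H L c(2) by linarith
  then have "cheb_ratio \<mu> (k - 1) + cheb_ratio \<mu> (l + 1) < \<mu>" using c(1) by simp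
  then have ratio: "cheb_ratio \<mu> (k - 1) + cheb_ratio \<mu> (l + 1) < cheb_ratio \<mu> k + cheb_ratio \<mu> l"
    using cheb_ratio_balance[OF cheb_pos assms(6,7)] by blast
  obtain z1 where z1: "\<And>p. z1 p > 0" "z1 (Spine 0) = xH v"
    "\<And>p. p \<in> verts (hyperpath r k) \<Longrightarrow> p \<noteq> Spine 0 \<Longrightarrow>
      local_form (hyperpath r k) z1 p = lam * z1 p ^ r"
    "local_form (hyperpath r k) z1 (Spine 0) = lam / \<mu> * xH v ^ r * cheb_ratio \<mu> k"
    using hyperpath_eigenvector_exists[OF lam r(1) xH_pos[OF v], of k, folded \<mu>_def]
      cheb_pos_le[OF assms(7)] by blast
  obtain z2 where z2: "\<And>p. z2 p > 0" "z2 (Spine 0) = xH v"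
    "\<And>p. p \<in> verts (hyperpath r l) \<Longrightarrow> p \<noteq> Spine 0 \<Longrightarrow>
      local_form (hyperpath r l) z2 p = lam * z2 p ^ r"
    "local_form (hyperpath r l) z2 (Spine 0) = lam / \<mu> * xH v ^ r * cheb_ratio \<mu> l"
    using hyperpath_eigenvector_exists[OF lam r(1) xH_pos[OF v], of l, folded \<mu>_def]
      cheb_pos_le[OF order_refl] by blast
  \<comment> \<open>The three pieces fit together because \<open>z1\<close> and \<open>z2\<close>
    take the value \<open>xH v\<close> at their roots.\<close>
  define z where "z = case_sum (case_sum xH z1) z2"
  have "(\<lambda>p. z (Inl (glue (Spine 0) v p))) = z1" "(\<lambda>p. z (glue (Spine 0) (Inl v) p)) = z2"
    "(\<lambda>w. z (Inl (Inl w))) = xH"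
    using z1(2) z2(2) by (auto simp: z_def glue_def)
  note form_z = form_G[where x = z, unfolded this]
  have "lam * xH v ^ r < local_form H xH v + c * (cheb_ratio \<mu> k + cheb_ratio \<mu> l)"
    using at_v L mult_strict_left_mono[OF ratio c(1)] by linarith
  then have strict: "lam * z (Inl (Inl v)) ^ r < local_form G z (Inl (Inl v))"
    using form_z(1)[of v] unfolding z1(4) z2(4) c_def[symmetric]
    by (simp add: z_def distrib_left)
  have "local_form G z u \<ge> lam * z u ^ r" if u: "u \<in> verts G" for u
  proof -
    \<comment> \<open>Away from \<open>v\<close> a vertex of \<open>H\<close> meets only edges of
      \<open>H\<close>, in both graphs, so its equation for \<open>x\<close> carries over.\<close>
    have "local_form G z (Inl (Inl w)) = lam * z (Inl (Inl w)) ^ r" if w: "w \<in> verts H" "w \<noteq> v" for w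
      using form_z(1)[of w] form_x(1)[of w] eig[of "Inl (Inl w)"] w
      unfolding verts_G' by (simp add: z_def xH_def)
    moreover have "local_form G z (Inl (Inr p)) = lam * z (Inl (Inr p)) ^ r"
      if "p \<in> verts (hyperpath r k) - {Spine 0}" for p
      using form_z(2)[of p] z1(3)[of p] that by (simp add: z_def)
    moreover have "local_form G z (Inr p) = lam * z (Inr p) ^ r"
      if "p \<in> verts (hyperpath r l) - {Spine 0}" for p
      using form_z(3)[of p] z2(3)[of p] that by (simp add: z_def)
    ultimately show ?thesis using u strict unfolding verts_G by fastforce
  qed
  moreover have "z u > 0" if "u \<in> verts G" for u
    using that xH_pos z1(1) z2(1) unfolding verts_G by (auto simp: z_def)
  moreover have "Inl (Inl v) \<in> verts G" using v unfolding verts_G by blast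
  ultimately have "fact (r - 1) * lam < spectral_radius r G"
    using strict attach_two_paths_hypergraph(1)[OF r(1) H, where k = k and l = l and v = v, folded G_def]
    by (intro spectral_radius_gt_of_local_form[of r G z lam "Inl (Inl v)"] r(2)) auto
  then show ?thesis by (simp add: lam_def G_def G'_def)
qed

end
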